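(* Let $G=(V,E)$ be a graph satisfying the exponential curvature dimension inequality $CDE(n,0)$. Then any harmonic function on $G$ of sub-square-root growth is constant. Furthermore, if a strong cut-off function exists for any large ball (i.e. there is a constant $c=c(n)$ such that for every $x_0\in V$ and all sufficiently large $R$ there exists a $(c,R)$-strong cut-off function centered at $x_0$ and supported on the ball $B_R(x_0)$), then any harmonic function on $G$ of sublinear growth is constant.
   Context: Graphs: $G=(V,E)$ is a locally finite, connected graph with a symmetric weight $\mu_{\cdot\cdot}:V\times V\to[0,\infty)$, $\mu_{xy}>0$ iff $x\sim y$ (neighbors), $\inf_{(x,y)\in E}\mu_{xy}>0$, $\deg(x):=\sum_{y}\mu_{xy}<\infty$. $m:V\to(0,\infty)$ is a measure on vertices. $D_\mu:=\max_{(x,y)\in E}\deg(x)/\mu_{xy}$ and $D_m:=\max_{x\in V}\deg(x)/m(x)$ are finite. $d$ is the combinatorial graph distance and $B_R(x)=\{y:d(x,y)\le R\}$. Laplacian: $\Delta f(x)=\frac1{m(x)}\sum_{y}\mu_{xy}(f(y)-f(x))$; $u:V\to\mathbb R$ is harmonic if $\Delta u=0$ on $V$. Growth: $u$ is of sub-square-root growth if $\max_{B_R(x)}|u|=o(R^{1/2})$ as $R\to\infty$, and of sublinear growth if $\max_{B_R(x)}|u|=o(R)$ as $R\to\infty$ (these do not depend on $x\in V$). Curvature: $\Gamma(f,g)=\frac12(\Delta(fg)-f\Delta g-g\Delta f)$, $\Gamma_2(f,g)=\frac12(\Delta\Gamma(f,g)-\Gamma(f,\Delta g)-\Gamma(\Delta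 f,g))$, $\Gamma(f)=\Gamma(f,f)$, $\Gamma_2(f)=\Gamma_2(f,f)$. For $n>0$ and $\kappa\in\mathbb R$, $G$ satisfies $CDE(n,\kappa)$ if for every vertex $x$ and every positive $f:V\to\mathbb R$ with $\Delta f(x)<0$ one has, at $x$, $\Gamma_2(f)-\Gamma\bigl(f,\frac{\Gamma(f)}{f}\bigr)\ge\frac1n(\Delta f)^2+\kappa\,\Gamma(f)$. Strong cut-off functions: let $G$ satisfy $CDE(n,-K)$ with $K\ge0$ (here $K=0$). A function $\phi:V\to[0,1]$ is a $(c,R)$-strong cut-off function centered at $x_0\in V$ and supported on $S\subset V$ if $\phi(x_0)=1$, $\phi(x)=0$ for $x\notin S$, and for every $x\in S$ either (1) $\phi(x)<\frac{c(1+R\sqrt K)}{2R^2}$, or (2) $\phi$ does not vanish in the immediate neighborhood of $x$ (at $x$ and its neighbors) and $\phi^2(x)\,\Delta\frac1\phi(x)\le D_m\frac{c(1+R\sqrt K)}{R^2}$ and $\phi^3(x)\,\Gamma\bigl(\frac1\phi\bigr)(x)\le D_m\frac{c}{R^2}$, where the constant $c=c(n)$ depends only on the dimension $n$. *)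

theory Defs
  imports Complex_Main "HOL-Library.Landau_Symbols"
begin

text \<open>
  The vertex set is the type \<open>'v\<close>. The edge set is determined by the weight: \<open>x \<sim> y\<close> iff
  \<open>\<mu> x y > 0\<close>. Loops are not excluded.
\<close>

definition edges :: "('v \<Rightarrow> 'v \<Rightarrow> real) \<Rightarrow> ('v \<times> 'v) set" where
  "edges \<mu> = {(x, y). \<mu> x y > 0}"

definition nbrs :: "('v \<Rightarrow> 'v \<Rightarrow> real) \<Rightarrow> 'v \<Rightarrow> 'v set" where
  "nbrs \<mu> x = {y. (x, y) \<in> edges \<mu>}"

text \<open>
  A sum over all vertices weighted by \<open>\<mu> x y\<close> is written as the sum over the neighbours of \<open>x\<close>,
  which is finite in a locally finite graph; all other terms vanish.
\<close>

definition deg :: "('v \<Rightarrow> 'v \<Rightarrow> real) \<Rightarrow> 'v \<Rightarrow> real" where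
  "deg \<mu> x = (\<Sum>y\<in>nbrs \<mu> x. \<mu> x y)"

text \<open>
  The last two assumptions say that \<open>D\<^sub>\<mu>\<close> and \<open>D\<^sub>m\<close> are finite. On an infinite graph these maxima
  are suprema.
\<close>

locale weighted_graph =
  fixes \<mu> :: "'v \<Rightarrow> 'v \<Rightarrow> real" and m :: "'v \<Rightarrow> real"
  assumes weight_nonneg: "\<mu> x y \<ge> 0"
    and weight_sym: "\<mu> x y = \<mu> y x"
    and weight_bounded_below: "\<exists>\<epsilon>>0. \<forall>(x, y)\<in>edges \<mu>. \<mu> x y \<ge> \<epsilon>"
    and locally_finite: "finite (nbrs \<mu> x)"
    and connected: "(x, y) \<in> (edges \<mu>)\<^sup>*"
    and measure_pos: "m x > 0"
    and D_mu_finite: "bdd_above ((\<lambda>(x, y). deg \<mu> x / \<mu> x y) ` edges \<mu>)"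
    and D_m_finite: "bdd_above (range (\<lambda>x. deg \<mu> x / m x))"

definition D_m :: "('v \<Rightarrow> 'v \<Rightarrow> real) \<Rightarrow> ('v \<Rightarrow> real) \<Rightarrow> real" where
  "D_m \<mu> m = (SUP x. deg \<mu> x / m x)"

definition gdist :: "('v \<Rightarrow> 'v \<Rightarrow> real) \<Rightarrow> 'v \<Rightarrow> 'v \<Rightarrow> nat" where
  "gdist \<mu> x y = (LEAST k. (x, y) \<in> edges \<mu> ^^ k)"

definition gball :: "('v \<Rightarrow> 'v \<Rightarrow> real) \<Rightarrow> 'v \<Rightarrow> real \<Rightarrow> 'v set" where
  "gball \<mu> x R = {y. real (gdist \<mu> x y) \<le> R}"

definition laplacian ::
    "('v \<Rightarrow> 'v \<Rightarrow> real) \<Rightarrow> ('v \<Rightarrow> real) \<Rightarrow> ('v \<Rightarrow> real) \<Rightarrow> 'v \<Rightarrow> real" where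
  "laplacian \<mu> m f x = 1 / m x * (\<Sum>y\<in>nbrs \<mu> x. \<mu> x y * (f y - f x))"

definition harmonic :: "('v \<Rightarrow> 'v \<Rightarrow> real) \<Rightarrow> ('v \<Rightarrow> real) \<Rightarrow> ('v \<Rightarrow> real) \<Rightarrow> bool" where
  "harmonic \<mu> m u \<longleftrightarrow> (\<forall>x. laplacian \<mu> m u x = 0)"

text \<open>
  The growth conditions below do not depend on the centre \<open>x\<close>, so as hypotheses they are only
  required for some centre. Balls are finite, and nonempty for \<open>R \<ge> 0\<close>.
\<close>

definition max_on_ball :: "('v \<Rightarrow> 'v \<Rightarrow> real) \<Rightarrow> ('v \<Rightarrow> real) \<Rightarrow> 'v \<Rightarrow> real \<Rightarrow> real" where
  "max_on_ball \<mu> u x R = Max ((\<lambda>y. \<bar>u y\<bar>) ` gball \<mu> x R)"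

definition sub_square_root_growth :: "('v \<Rightarrow> 'v \<Rightarrow> real) \<Rightarrow> ('v \<Rightarrow> real) \<Rightarrow> bool" where
  "sub_square_root_growth \<mu> u \<longleftrightarrow> (\<exists>x. max_on_ball \<mu> u x \<in> o[at_top](\<lambda>R. R powr (1/2)))"

definition sublinear_growth :: "('v \<Rightarrow> 'v \<Rightarrow> real) \<Rightarrow> ('v \<Rightarrow> real) \<Rightarrow> bool" where
  "sublinear_growth \<mu> u \<longleftrightarrow> (\<exists>x. max_on_ball \<mu> u x \<in> o[at_top](\<lambda>R. R))"

definition Gamma ::
    "('v \<Rightarrow> 'v \<Rightarrow> real) \<Rightarrow> ('v \<Rightarrow> real) \<Rightarrow> ('v \<Rightarrow> real) \<Rightarrow> ('v \<Rightarrow> real) \<Rightarrow> 'v \<Rightarrow> real" where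
  "Gamma \<mu> m f g x =
     1/2 * (laplacian \<mu> m (\<lambda>y. f y * g y) x - f x * laplacian \<mu> m g x - g x * laplacian \<mu> m f x)"

definition Gamma2 ::
    "('v \<Rightarrow> 'v \<Rightarrow> real) \<Rightarrow> ('v \<Rightarrow> real) \<Rightarrow> ('v \<Rightarrow> real) \<Rightarrow> ('v \<Rightarrow> real) \<Rightarrow> 'v \<Rightarrow> real" where
  "Gamma2 \<mu> m f g x =
     1/2 * (laplacian \<mu> m (Gamma \<mu> m f g) x
            - Gamma \<mu> m f (laplacian \<mu> m g) x - Gamma \<mu> m (laplacian \<mu> m f) g x)"

definition CDE :: "('v \<Rightarrow> 'v \<Rightarrow> real) \<Rightarrow> ('v \<Rightarrow> real) \<Rightarrow> real \<Rightarrow> real \<Rightarrow> bool" where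
  "CDE \<mu> m n \<kappa> \<longleftrightarrow>
     (\<forall>x f. (\<forall>y. f y > 0) \<and> laplacian \<mu> m f x < 0 \<longrightarrow>
        Gamma2 \<mu> m f f x - Gamma \<mu> m f (\<lambda>y. Gamma \<mu> m f f y / f y) x
          \<ge> 1 / n * (laplacian \<mu> m f x)\<^sup>2 + \<kappa> * Gamma \<mu> m f f x)"

text \<open>
  Here \<open>K \<ge> 0\<close> is the constant of the ambient curvature condition \<open>CDE(n, -K)\<close>.
\<close>

definition strong_cutoff ::
    "('v \<Rightarrow> 'v \<Rightarrow> real) \<Rightarrow> ('v \<Rightarrow> real) \<Rightarrow> real \<Rightarrow> real \<Rightarrow> real \<Rightarrow> 'v \<Rightarrow> 'v set \<Rightarrow> ('v \<Rightarrow> real) \<Rightarrow> bool"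
  where
  "strong_cutoff \<mu> m K c R x0 S \<phi> \<longleftrightarrow>
     (\<forall>x. 0 \<le> \<phi> x \<and> \<phi> x \<le> 1) \<and> \<phi> x0 = 1 \<and> (\<forall>x. x \<notin> S \<longrightarrow> \<phi> x = 0) \<and>
     (\<forall>x\<in>S.
        \<phi> x < c * (1 + R * sqrt K) / (2 * R\<^sup>2) \<or>
        ((\<forall>y\<in>insert x (nbrs \<mu> x). \<phi> y \<noteq> 0) \<and>
         (\<phi> x)\<^sup>2 * laplacian \<mu> m (\<lambda>y. 1 / \<phi> y) x \<le> D_m \<mu> m * (c * (1 + R * sqrt K) / R\<^sup>2) \<and>
         (\<phi> x) ^ 3 * Gamma \<mu> m (\<lambda>y. 1 / \<phi> y) (\<lambda>y. 1 / \<phi> y) x \<le> D_m \<mu> m * (c / R\<^sup>2)))"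

end

theory Submission
  imports Defs "HOL-Real_Asymp.Real_Asymp"
begin

text \<open>
  Let \<open>u\<close> be harmonic with \<open>\<bar>u\<bar> \<le> N\<close> on a large ball and put \<open>f = sqrt (u + 2 N)\<close>, \<open>g = \<Gamma>(f)\<close>.
  Since \<open>f\<^sup>2\<close> is harmonic, \<open>f \<Delta>f = - \<Gamma>(f)\<close>, and the left-hand side of \<open>CDE(n, 0)\<close> collapses to
  \<open>\<Delta>g / 2\<close>. Hence \<open>\<Delta>g \<ge> (2/n) (g/f)\<^sup>2\<close>. At a maximum of \<open>\<phi> g\<close>, for a cut-off function \<open>\<phi>\<close>, one has
  \<open>\<Delta>g \<le> g \<phi> \<Delta>(1/\<phi>)\<close>, so \<open>g\<close> is at most \<open>C N b\<close> at the centre, where \<open>b\<close> measures the quality of the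
  cut-off: \<open>b = 2/R\<close> for \<open>\<phi> = 1 - d/R\<close>, and \<open>b = \<bar>c\<bar>/R\<^sup>2\<close> for a strong cut-off. As
  \<open>(u y - u x)\<^sup>2 = (f y - f x)\<^sup>2 (f y + f x)\<^sup>2\<close>, the increments of \<open>u\<close> at the centre are \<open>O(N sqrt b)\<close>,
  which tends to \<open>0\<close> under the growth hypotheses.
\<close>

context weighted_graph
begin

section \<open>Graph distance and finite balls\<close>

lemma gdist_relpow: "(x, y) \<in> edges \<mu> ^^ gdist \<mu> x y"
  unfolding gdist_def using connected[of x y] by (metis LeastI rtrancl_power)

lemma gdist_le: "(x, y) \<in> edges \<mu> ^^ k \<Longrightarrow> gdist \<mu> x y \<le> k"
  unfolding gdist_def by (rule Least_le)

lemma gdist_refl [simp]: "gdist \<mu> x x = 0"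
  using gdist_le[of x x 0] by simp

lemma gdist_triangle: "gdist \<mu> x z \<le> gdist \<mu> x y + gdist \<mu> y z"
  by (rule gdist_le) (use gdist_relpow[of x y] gdist_relpow[of y z] in \<open>auto simp: relpow_add\<close>)

lemma gdist_nbrs:
  assumes "z \<in> nbrs \<mu> y"
  shows "gdist \<mu> x z \<le> gdist \<mu> x y + 1"
proof -
  have "gdist \<mu> y z \<le> 1"
    using assms by (intro gdist_le) (simp add: nbrs_def)
  then show ?thesis
    using gdist_triangle[of x z y] by linarith
qed

lemma gball_nbrs: "y \<in> gball \<mu> x R \<Longrightarrow> z \<in> nbrs \<mu> y \<Longrightarrow> z \<in> gball \<mu> x (R + 1)"
  using gdist_nbrs[of z y x] by (simp add: gball_def)

lemma gball_mono: "R \<le> R' \<Longrightarrow> gball \<mu> x R \<subseteq> gball \<mu> x R'"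
  by (auto simp: gball_def)

text \<open>Moves the centre of a growth bound: growth is assumed around a single point, whereas
  increments are estimated at every vertex.\<close>

lemma gball_subset_gball: "gball \<mu> x R \<subseteq> gball \<mu> p (R + real (gdist \<mu> p x))"
proof
  fix z assume "z \<in> gball \<mu> x R"
  then show "z \<in> gball \<mu> p (R + real (gdist \<mu> p x))"
    using gdist_triangle[of p z x] by (simp add: gball_def)
qed

lemma finite_relpow_edges: "finite {y. (x, y) \<in> edges \<mu> ^^ k}"
proof (induction k)
  case (Suc k)
  have "{y. (x, y) \<in> edges \<mu> ^^ Suc k} \<subseteq> (\<Union>z\<in>{z. (x, z) \<in> edges \<mu> ^^ k}. nbrs \<mu> z)"
    by (auto simp: nbrs_def)
  then show ?case
    using Suc locally_finite by (meson finite_UN finite_subset)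
qed auto

text \<open>Finiteness makes \<open>max_on_ball\<close> a genuine maximum and lets the maximum
  principle pick a maximising vertex.\<close>

lemma finite_gball: "finite (gball \<mu> x R)"
proof -
  have "gball \<mu> x R \<subseteq> (\<Union>k\<in>{..nat \<lfloor>R\<rfloor>}. {y. (x, y) \<in> edges \<mu> ^^ k})"
    using gdist_relpow[of x] by (fastforce simp: gball_def intro: le_nat_floor)
  then show ?thesis
    using finite_relpow_edges by (meson finite_UN finite_atMost finite_subset)
qed

lemma abs_le_max_on_ball: "y \<in> gball \<mu> x R \<Longrightarrow> \<bar>u y\<bar> \<le> max_on_ball \<mu> u x R"
  unfolding max_on_ball_def by (intro Max_ge finite_imageI finite_gball) auto

section \<open>Calculus of the Laplacian and of \<open>Gamma\<close>\<close>

lemma deg_div_le_D_m: "deg \<mu> x / m x \<le> D_m \<mu> m"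
  unfolding D_m_def using D_m_finite by (intro cSUP_upper) auto

lemma D_m_nonneg: "0 \<le> D_m \<mu> m"
proof -
  have "0 \<le> deg \<mu> x / m x" for x
    unfolding deg_def using weight_nonneg measure_pos[of x]
    by (intro divide_nonneg_pos sum_nonneg) auto
  then show ?thesis
    using deg_div_le_D_m order_trans by blast
qed

lemma laplacian_cong:
  assumes "\<And>y. y \<in> insert x (nbrs \<mu> x) \<Longrightarrow> f y = g y"
  shows "laplacian \<mu> m f x = laplacian \<mu> m g x"
  unfolding laplacian_def using assms by (auto intro!: sum.cong)

lemma laplacian_add_const: "laplacian \<mu> m (\<lambda>y. f y + a) x = laplacian \<mu> m f x"
  unfolding laplacian_def by simp

text \<open>Serves twice: for \<open>-f\<close> with \<open>f\<close> positive, where increments are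
  at most \<open>f x\<close>, and for the reciprocal of the linear cut-off.\<close>

lemma laplacian_le_of_increments:
  assumes "\<And>y. y \<in> nbrs \<mu> x \<Longrightarrow> f y - f x \<le> a" and "0 \<le> a"
  shows "laplacian \<mu> m f x \<le> D_m \<mu> m * a"
proof -
  have "laplacian \<mu> m f x \<le> 1 / m x * (\<Sum>y\<in>nbrs \<mu> x. \<mu> x y * a)"
    unfolding laplacian_def using assms weight_nonneg measure_pos[of x]
    by (intro mult_left_mono sum_mono) auto
  also have "\<dots> = deg \<mu> x / m x * a"
    by (simp add: deg_def sum_distrib_right)
  also have "\<dots> \<le> D_m \<mu> m * a"
    using deg_div_le_D_m assms by (intro mult_right_mono) auto
  finally show ?thesis .
qed

lemma Gamma_altdef:
  "Gamma \<mu> m f g x = 1 / (2 * m x) * (\<Sum>y\<in>nbrs \<mu> x. \<mu> x y * ((f y - f x) * (g y - g x)))"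
proof -
  have eq: "(\<Sum>y\<in>nbrs \<mu> x. \<mu> x y * ((f y - f x) * (g y - g x))) =
     (\<Sum>y\<in>nbrs \<mu> x. \<mu> x y * (f y * g y - f x * g x))
     - f x * (\<Sum>y\<in>nbrs \<mu> x. \<mu> x y * (g y - g x)) - g x * (\<Sum>y\<in>nbrs \<mu> x. \<mu> x y * (f y - f x))"
    by (simp add: sum_distrib_left flip: sum_subtractf) (simp add: algebra_simps)
  show ?thesis
    unfolding Gamma_def laplacian_def eq by (simp add: diff_divide_distrib mult_ac)
qed

lemma Gamma_commute: "Gamma \<mu> m f g x = Gamma \<mu> m g f x"
  unfolding Gamma_altdef by (simp add: mult.commute)

lemma Gamma_add_right:
  "Gamma \<mu> m f g x + Gamma \<mu> m f h x = Gamma \<mu> m f (\<lambda>y. g y + h y) x"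
  unfolding Gamma_altdef
  by (simp add: sum.distrib[symmetric] distrib_left[symmetric] flip: add_divide_distrib)
    (simp add: algebra_simps)

lemma Gamma_zero_right:
  assumes "\<And>y. y \<in> insert x (nbrs \<mu> x) \<Longrightarrow> g y = 0"
  shows "Gamma \<mu> m f g x = 0"
  unfolding Gamma_altdef using assms by simp

lemma Gamma_nonneg: "0 \<le> Gamma \<mu> m f f x"
  unfolding Gamma_altdef using weight_nonneg measure_pos[of x] by (simp add: sum_nonneg)

lemma increment_le_Gamma:
  assumes "y \<in> nbrs \<mu> x"
  shows "\<mu> x y * (f y - f x)\<^sup>2 \<le> 2 * m x * Gamma \<mu> m f f x"
proof -
  have "\<mu> x y * (f y - f x)\<^sup>2 \<le> (\<Sum>z\<in>nbrs \<mu> x. \<mu> x z * (f z - f x)\<^sup>2)"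
    using assms weight_nonneg
    by (intro member_le_sum[where f = "\<lambda>z. \<mu> x z * (f z - f x)\<^sup>2"] locally_finite) auto
  also have "\<dots> = 2 * m x * Gamma \<mu> m f f x"
    unfolding Gamma_altdef using measure_pos[of x] by (simp add: power2_eq_square)
  finally show ?thesis .
qed

section \<open>Functions with harmonic square under the curvature condition\<close>

lemma Gamma_of_sqrt_harmonic:
  assumes "laplacian \<mu> m (\<lambda>y. f y * f y) x = 0"
  shows "Gamma \<mu> m f f x = - f x * laplacian \<mu> m f x"
  unfolding Gamma_def using assms by simp

text \<open>A crude bound that uses no curvature. It handles a maximum point at which the cut-off
  itself is small.\<close>

lemma Gamma_le_of_sqrt_harmonic:
  assumes "laplacian \<mu> m (\<lambda>y. f y * f y) x = 0" and "\<And>y. f y > 0"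
  shows "Gamma \<mu> m f f x \<le> D_m \<mu> m * (f x)\<^sup>2"
proof -
  have "- laplacian \<mu> m f x = laplacian \<mu> m (\<lambda>y. - f y) x"
    unfolding laplacian_def by (simp add: right_diff_distrib sum_subtractf sum_negf diff_divide_distrib)
  also have "\<dots> \<le> D_m \<mu> m * f x"
    using assms(2) by (intro laplacian_le_of_increments) (auto intro: less_imp_le)
  finally have "f x * (- laplacian \<mu> m f x) \<le> f x * (D_m \<mu> m * f x)"
    using assms(2)[of x] by (intro mult_left_mono) auto
  then show ?thesis
    using Gamma_of_sqrt_harmonic[OF assms(1)] by (simp add: power2_eq_square algebra_simps)
qed

text \<open>Harmonicity of the square is needed at the neighbours too, because
  \<open>Gamma \<mu> m f (laplacian \<mu> m f) x\<close> reads the Laplacian there. Substituting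
  \<open>- Gamma \<mu> m f f / f\<close> for it makes this term cancel the correction term of
  \<open>CDE\<close>.\<close>

lemma laplacian_Gamma_ge:
  assumes "CDE \<mu> m n 0" and pos: "\<And>y. f y > 0"
    and harm: "\<And>z. z \<in> insert x (nbrs \<mu> x) \<Longrightarrow> laplacian \<mu> m (\<lambda>y. f y * f y) z = 0"
  shows "2 / n * (Gamma \<mu> m f f x / f x)\<^sup>2 \<le> laplacian \<mu> m (Gamma \<mu> m f f) x"
\<comment> \<open>At a zero of \<open>Gamma \<mu> m f f\<close> the Laplacian of \<open>f\<close> is
  0, so the premise of \<open>CDE\<close> fails; but the nonnegative function
  \<open>Gamma \<mu> m f f\<close> then has a minimum at \<open>x\<close>.\<close>
proof (cases "Gamma \<mu> m f f x = 0")
  case True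
  then show ?thesis
    unfolding laplacian_def True using weight_nonneg measure_pos[of x] Gamma_nonneg
    by (auto intro!: divide_nonneg_pos sum_nonneg mult_nonneg_nonneg)
next
  case False
  have lap: "laplacian \<mu> m f z = - (Gamma \<mu> m f f z / f z)" if "z \<in> insert x (nbrs \<mu> x)" for z
    using Gamma_of_sqrt_harmonic[OF harm[OF that]] pos[of z] by (simp add: field_simps)
  have "Gamma \<mu> m f f x > 0"
    using False Gamma_nonneg[of f x] by linarith
  then have "laplacian \<mu> m f x < 0"
    using lap[of x] pos[of x] by simp
  then have "1 / n * (laplacian \<mu> m f x)\<^sup>2
      \<le> Gamma2 \<mu> m f f x - Gamma \<mu> m f (\<lambda>y. Gamma \<mu> m f f y / f y) x"
    using assms(1) pos unfolding CDE_def by fastforce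
  also have "\<dots> = laplacian \<mu> m (Gamma \<mu> m f f) x / 2
      - (Gamma \<mu> m f (laplacian \<mu> m f) x + Gamma \<mu> m f (\<lambda>y. Gamma \<mu> m f f y / f y) x)"
    unfolding Gamma2_def Gamma_commute[of "laplacian \<mu> m f" f] by (simp add: field_simps)
  also have "Gamma \<mu> m f (laplacian \<mu> m f) x + Gamma \<mu> m f (\<lambda>y. Gamma \<mu> m f f y / f y) x = 0"
    unfolding Gamma_add_right by (rule Gamma_zero_right) (simp add: lap)
  finally show ?thesis
    using lap[of x] by (simp add: field_simps)
qed

section \<open>The maximum principle with a cut-off\<close>

definition cutoff :: "'v \<Rightarrow> real \<Rightarrow> real \<Rightarrow> ('v \<Rightarrow> real) \<Rightarrow> bool" where
  "cutoff x0 R b \<phi> \<longleftrightarrow>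
     (\<forall>x. 0 \<le> \<phi> x) \<and> \<phi> x0 = 1 \<and> (\<forall>x. x \<notin> gball \<mu> x0 R \<longrightarrow> \<phi> x = 0) \<and>
     (\<forall>x\<in>gball \<mu> x0 R. \<phi> x \<le> b \<or>
        ((\<forall>y\<in>insert x (nbrs \<mu> x). \<phi> y > 0) \<and>
         (\<phi> x)\<^sup>2 * laplacian \<mu> m (\<lambda>y. 1 / \<phi> y) x \<le> D_m \<mu> m * b))"

text \<open>On the neighbours \<open>g\<close> lies below \<open>\<phi> x * g x / \<phi>\<close>,
  with equality at \<open>x\<close>, so the Laplacians at \<open>x\<close> compare in the same
  order.\<close>

lemma laplacian_le_at_max:
  assumes max: "\<And>y. y \<in> nbrs \<mu> x \<Longrightarrow> \<phi> y * g y \<le> \<phi> x * g x"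
    and pos: "\<And>y. y \<in> insert x (nbrs \<mu> x) \<Longrightarrow> \<phi> y > 0"
  shows "laplacian \<mu> m g x \<le> \<phi> x * g x * laplacian \<mu> m (\<lambda>y. 1 / \<phi> y) x"
proof -
  have "laplacian \<mu> m g x
      \<le> 1 / m x * (\<Sum>y\<in>nbrs \<mu> x. \<mu> x y * (\<phi> x * g x * (1 / \<phi> y - 1 / \<phi> x)))"
    unfolding laplacian_def
  proof (intro mult_left_mono sum_mono)
    fix y assume y: "y \<in> nbrs \<mu> x"
    have "\<phi> x > 0" "\<phi> y > 0" "g y \<le> \<phi> x * g x / \<phi> y"
      using pos y max[OF y] by (auto simp: field_simps)
    then show "g y - g x \<le> \<phi> x * g x * (1 / \<phi> y - 1 / \<phi> x)"
      by (simp add: algebra_simps)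
  qed (use weight_nonneg measure_pos[of x] in auto)
  also have "\<dots> = \<phi> x * g x * laplacian \<mu> m (\<lambda>y. 1 / \<phi> y) x"
    unfolding laplacian_def by (simp add: sum_distrib_left mult_ac)
  finally show ?thesis .
qed

text \<open>The two alternatives in \<open>cutoff\<close> at a maximum point bound
  \<open>\<phi> * Gamma \<mu> m f f\<close> by \<open>D_m \<mu> m * b * L\<close> times 1 and times
  \<open>n / 2\<close>; the factor \<open>1 + n\<close> covers both.\<close>

lemma Gamma_le_at_centre:
  assumes CDE: "CDE \<mu> m n 0" and n: "n > 0" and pos: "\<And>y. f y > 0" and R: "0 \<le> R"
    and harm: "\<And>z. z \<in> gball \<mu> x0 (R + 1) \<Longrightarrow> laplacian \<mu> m (\<lambda>y. f y * f y) z = 0"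
    and bound: "\<And>z. z \<in> gball \<mu> x0 R \<Longrightarrow> (f z)\<^sup>2 \<le> L"
    and cutoff: "cutoff x0 R b \<phi>" and b: "0 \<le> b"
  shows "Gamma \<mu> m f f x0 \<le> (1 + n) * D_m \<mu> m * b * L"
proof -
  define g where "g = Gamma \<mu> m f f"
  have x0: "x0 \<in> gball \<mu> x0 R"
    using R by (simp add: gball_def)
  have L: "0 \<le> L"
    using bound[OF x0] zero_le_power2 order_trans by blast
  have g: "0 \<le> g y" for y
    by (simp add: g_def Gamma_nonneg)
  have \<phi>: "0 \<le> \<phi> y" "\<phi> x0 = 1" "y \<notin> gball \<mu> x0 R \<Longrightarrow> \<phi> y = 0" for y
    using cutoff by (auto simp: cutoff_def)
  obtain x where x: "x \<in> gball \<mu> x0 R"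
    and max_ball: "\<And>y. y \<in> gball \<mu> x0 R \<Longrightarrow> \<phi> y * g y \<le> \<phi> x * g x"
  proof -
    have "Max ((\<lambda>y. \<phi> y * g y) ` gball \<mu> x0 R) \<in> (\<lambda>y. \<phi> y * g y) ` gball \<mu> x0 R"
      using x0 by (intro Max_in finite_imageI finite_gball) auto
    then obtain x where "x \<in> gball \<mu> x0 R" "Max ((\<lambda>y. \<phi> y * g y) ` gball \<mu> x0 R) = \<phi> x * g x"
      by auto
    moreover have "\<phi> y * g y \<le> Max ((\<lambda>y. \<phi> y * g y) ` gball \<mu> x0 R)" if "y \<in> gball \<mu> x0 R" for y
      using that by (intro Max_ge finite_imageI finite_gball) auto
    ultimately show thesis
      using that by metis
  qed
  \<comment> \<open>The maximum is global because \<open>\<phi>\<close> vanishes off the ball; this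
    matters as neighbours of \<open>x\<close> may lie outside.\<close>
  have max: "\<phi> y * g y \<le> \<phi> x * g x" for y
    using max_ball[of y] \<phi>(1)[of x] \<phi>(3)[of y] g[of x] by (cases "y \<in> gball \<mu> x0 R") auto
  have harm_x: "laplacian \<mu> m (\<lambda>y. f y * f y) z = 0" if "z \<in> insert x (nbrs \<mu> x)" for z
    using that x gball_nbrs[of x x0 R z] gball_mono[of R "R + 1" x0] by (intro harm) auto
  have gx: "g x \<le> D_m \<mu> m * L"
  proof -
    have "g x \<le> D_m \<mu> m * (f x)\<^sup>2"
      unfolding g_def using harm_x pos by (intro Gamma_le_of_sqrt_harmonic) auto
    also have "\<dots> \<le> D_m \<mu> m * L"
      using bound[OF x] D_m_nonneg by (intro mult_left_mono)
    finally show ?thesis .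
  qed
  have DbL: "0 \<le> D_m \<mu> m * b * L"
    using D_m_nonneg b L by simp
  consider "\<phi> x \<le> b" | "\<And>y. y \<in> insert x (nbrs \<mu> x) \<Longrightarrow> \<phi> y > 0"
      "(\<phi> x)\<^sup>2 * laplacian \<mu> m (\<lambda>y. 1 / \<phi> y) x \<le> D_m \<mu> m * b"
    using cutoff x by (auto simp: cutoff_def)
  then have "\<phi> x * g x \<le> (1 + n) * (D_m \<mu> m * b * L)"
  proof cases
    case 1
    then have "\<phi> x * g x \<le> b * (D_m \<mu> m * L)"
      using gx g b by (intro mult_mono) auto
    also have "\<dots> \<le> (1 + n) * (D_m \<mu> m * b * L)"
      using mult_nonneg_nonneg[OF less_imp_le[OF n] DbL] by (simp add: algebra_simps)
    finally show ?thesis .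
  next
    case 2
    show ?thesis
    proof (cases "g x = 0")
      case True
      then show ?thesis
        using n DbL by simp
    next
      case False
      then have gx0: "g x > 0"
        using g[of x] by linarith
      have fx: "0 < (f x)\<^sup>2" "(f x)\<^sup>2 \<le> L"
        using pos[of x] bound[OF x] by auto
      have "2 / n * (g x)\<^sup>2 / (f x)\<^sup>2 \<le> laplacian \<mu> m g x"
        using laplacian_Gamma_ge[OF CDE pos harm_x] by (simp add: g_def power_divide)
      also have "\<dots> \<le> \<phi> x * g x * laplacian \<mu> m (\<lambda>y. 1 / \<phi> y) x"
        using max 2(1) by (intro laplacian_le_at_max) auto
      finally have "2 / n * g x / (f x)\<^sup>2 \<le> \<phi> x * laplacian \<mu> m (\<lambda>y. 1 / \<phi> y) x"
        using gx0 fx n by (simp add: field_simps power2_eq_square)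
      \<comment> \<open>The extra factor \<open>\<phi> x\<close> produces the square in front of the
        Laplacian of \<open>1 / \<phi>\<close>, the quantity that \<open>cutoff\<close>
        controls.\<close>
      then have "\<phi> x * (2 / n * g x / (f x)\<^sup>2) \<le> \<phi> x * (\<phi> x * laplacian \<mu> m (\<lambda>y. 1 / \<phi> y) x)"
        using \<phi>(1) by (intro mult_left_mono) auto
      also have "\<dots> \<le> D_m \<mu> m * b"
        using 2(2) by (simp add: power2_eq_square mult_ac)
      finally have "2 * (\<phi> x * g x) \<le> n * (D_m \<mu> m * b) * (f x)\<^sup>2"
        using n fx by (simp add: field_simps)
      also have "\<dots> \<le> n * (D_m \<mu> m * b) * L"
        using n fx D_m_nonneg b by (intro mult_left_mono) auto
      finally have "2 * (\<phi> x * g x) \<le> n * (D_m \<mu> m * b * L)"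
        by (simp add: mult_ac)
      moreover have "0 \<le> n * (D_m \<mu> m * b * L)"
        using n DbL by simp
      ultimately show ?thesis
        using DbL by (simp add: distrib_right)
    qed
  qed
  with max[of x0] show ?thesis
    unfolding g_def \<phi>(2) by (simp add: mult_ac)
qed

section \<open>From the gradient bound to a Liouville property\<close>

text \<open>The radius grows by two: one step for the curvature inequality at a boundary point,
  which needs harmonicity at its neighbours, and one for the Laplacian at those neighbours.\<close>

lemma harmonic_increment_le:
  assumes CDE: "CDE \<mu> m n 0" and n: "n > 0" and u: "harmonic \<mu> m u" and R: "0 \<le> R"
    and N: "N > 0" and bound: "\<And>y. y \<in> gball \<mu> x0 (R + 2) \<Longrightarrow> \<bar>u y\<bar> \<le> N"
    and cutoff: "cutoff x0 R b \<phi>" and b: "0 \<le> b" and y: "y \<in> nbrs \<mu> x0"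
  shows "\<mu> x0 y * (u y - u x0)\<^sup>2 \<le> 72 * m x0 * (1 + n) * D_m \<mu> m * (b * N\<^sup>2)"
proof -
  \<comment> \<open>truncated below because CDE quantifies over globally positive functions\<close>
  define f where "f z = sqrt (max (u z + 2 * N) N)" for z
  have pos: "f z > 0" for z
    using N by (simp add: f_def)
  have f2: "f z * f z = u z + 2 * N" if "z \<in> gball \<mu> x0 (R + 2)" for z
    using bound[OF that] N by (simp add: f_def)
  have f_le: "(f z)\<^sup>2 \<le> 3 * N" if "z \<in> gball \<mu> x0 (R + 2)" for z
    using bound[OF that] f2[OF that] by (simp add: power2_eq_square)
  have x0: "x0 \<in> gball \<mu> x0 (R + 2)" and y': "y \<in> gball \<mu> x0 (R + 2)"
    using R gdist_nbrs[OF y, of x0] by (auto simp: gball_def)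
  have "laplacian \<mu> m (\<lambda>y. f y * f y) z = 0" if "z \<in> gball \<mu> x0 (R + 1)" for z
  proof -
    have "laplacian \<mu> m (\<lambda>y. f y * f y) z = laplacian \<mu> m (\<lambda>y. u y + 2 * N) z"
      using that gball_nbrs[of z x0 "R + 1"] gball_mono[of "R + 1" "R + 2" x0]
      by (intro laplacian_cong f2) (auto simp: add.assoc)
    then show ?thesis
      using u by (simp add: laplacian_add_const harmonic_def)
  qed
  then have Gam: "Gamma \<mu> m f f x0 \<le> (1 + n) * D_m \<mu> m * b * (3 * N)"
    using gball_mono[of R "R + 2" x0]
    by (intro Gamma_le_at_centre[OF CDE n pos R _ _ cutoff b] f_le) auto
  \<comment> \<open>The square of a sum is at most twice the sum of squares, each of which is at
    most \<open>3 * N\<close>.\<close>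
  have sum_sq: "(f y + f x0)\<^sup>2 \<le> 12 * N"
    using f_le[OF y'] f_le[OF x0] sum_squares_bound[of "f y" "f x0"]
    by (simp add: power2_sum)
  have "\<mu> x0 y * (u y - u x0)\<^sup>2 = \<mu> x0 y * (f y - f x0)\<^sup>2 * (f y + f x0)\<^sup>2"
  proof -
    have "u y - u x0 = (f y - f x0) * (f y + f x0)"
      using f2[OF y'] f2[OF x0] by (simp add: algebra_simps)
    then show ?thesis
      by (simp add: power_mult_distrib)
  qed
  also have "\<dots> \<le> (2 * m x0 * Gamma \<mu> m f f x0) * (12 * N)"
    using measure_pos[of x0] Gamma_nonneg[of f x0]
    by (intro mult_mono[OF increment_le_Gamma[OF y] sum_sq]) auto
  \<comment> \<open>The constant 72 is 2 * 3 * 12.\<close>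
  also have "\<dots> \<le> (2 * m x0 * ((1 + n) * D_m \<mu> m * b * (3 * N))) * (12 * N)"
    using Gam N measure_pos[of x0] by (intro mult_right_mono mult_left_mono) auto
  finally show ?thesis
    by (simp add: power2_eq_square mult_ac)
qed

lemma constant_if_nbrs_eq:
  assumes "\<And>x y. y \<in> nbrs \<mu> x \<Longrightarrow> u y = u x"
  shows "\<exists>a. \<forall>x. u x = a"
proof -
  have "u y = u x" for x y
    using connected[of x y] by induction (use assms in \<open>auto simp: nbrs_def\<close>)
  then show ?thesis
    by blast
qed

text \<open>Here \<open>h\<close> is the growth scale, and a cut-off of quality
  \<open>C / (h R)\<^sup>2\<close> exactly balances the square of a function that is
  \<open>o(h)\<close>. The doubling condition on shifts absorbs the change of centre and the
  enlarged radius.\<close>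

lemma harmonic_constant_of_growth:
  assumes CDE: "CDE \<mu> m n 0" and n: "n > 0" and u: "harmonic \<mu> m u"
    and growth: "max_on_ball \<mu> u p \<in> o[at_top](h)"
    and h_pos: "\<forall>\<^sub>F R in at_top. h R > 0"
    and h_shift: "\<And>k. \<forall>\<^sub>F R in at_top. h (R + k) \<le> 2 * h R"
    and C: "0 \<le> C" and cutoffs: "\<And>x0. \<forall>\<^sub>F R in at_top. \<exists>\<phi>. cutoff x0 R (C / (h R)\<^sup>2) \<phi>"
  shows "\<exists>a. \<forall>x. u x = a"
proof (rule constant_if_nbrs_eq)
  fix x0 y assume y: "y \<in> nbrs \<mu> x0"
  \<comment> \<open>The final factor 4 is the square of the 2 in \<open>h_shift\<close>.\<close>
  define A where "A = 72 * m x0 * (1 + n) * D_m \<mu> m * C * 4"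
  \<comment> \<open>Chosen so that the ball of radius \<open>R + 2\<close> about \<open>x0\<close>
    lies in the ball of radius \<open>R + k\<close> about \<open>p\<close>.\<close>
  define k where "k = 2 + real (gdist \<mu> p x0)"
  have A: "0 \<le> A"
    using n C D_m_nonneg measure_pos[of x0] by (simp add: A_def)
  have bound: "\<mu> x0 y * (u y - u x0)\<^sup>2 \<le> A * e\<^sup>2" if e: "e > 0" for e
  proof -
    have shift: "filterlim (\<lambda>R::real. R + k) at_top at_top"
      by real_asymp
    have "\<forall>\<^sub>F R in at_top. h (R + k) > 0"
      using eventually_compose_filterlim[OF h_pos shift] .
    moreover have "\<forall>\<^sub>F R in at_top. norm (max_on_ball \<mu> u p (R + k)) \<le> e * norm (h (R + k))"
      using eventually_compose_filterlim[OF landau_o.smallD[OF growth e] shift] .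
    ultimately have "\<forall>\<^sub>F R :: real in at_top. \<mu> x0 y * (u y - u x0)\<^sup>2 \<le> A * e\<^sup>2"
      using h_pos h_shift[of k] cutoffs[of x0] eventually_ge_at_top[of 0]
    proof eventually_elim
      case (elim R)
      then obtain \<phi> where \<phi>: "cutoff x0 R (C / (h R)\<^sup>2) \<phi>"
        by blast
      define N where "N = e * h (R + k)"
      have N: "N > 0"
        using elim e by (simp add: N_def)
      have "\<bar>u z\<bar> \<le> N" if "z \<in> gball \<mu> x0 (R + 2)" for z
      proof -
        have "z \<in> gball \<mu> p (R + k)"
          using that gball_subset_gball[of x0 "R + 2" p] by (auto simp: k_def add.assoc)
        from abs_le_max_on_ball[OF this, of u] show ?thesis
          using elim(1,2) by (simp add: N_def)
      qed
      then have "\<mu> x0 y * (u y - u x0)\<^sup>2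
          \<le> 72 * m x0 * (1 + n) * D_m \<mu> m * (C / (h R)\<^sup>2 * N\<^sup>2)"
        using C elim by (intro harmonic_increment_le[OF CDE n u _ N _ \<phi> _ y]) auto
      also have "\<dots> \<le> 72 * m x0 * (1 + n) * D_m \<mu> m * (C * (4 * e\<^sup>2))"
      proof (intro mult_left_mono)
        have "C / (h R)\<^sup>2 * N\<^sup>2 \<le> C / (h R)\<^sup>2 * (e * (2 * h R))\<^sup>2"
          using C N e elim unfolding N_def by (intro mult_left_mono power_mono) auto
        also have "\<dots> = C * (4 * e\<^sup>2)"
          using elim by (simp add: field_simps power2_eq_square)
        finally show "C / (h R)\<^sup>2 * N\<^sup>2 \<le> C * (4 * e\<^sup>2)" .
      qed (use n D_m_nonneg measure_pos[of x0] in auto)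
      finally show ?case
        by (simp only: A_def mult_ac)
    qed
    then show ?thesis
      by simp
  qed
  have "\<mu> x0 y * (u y - u x0)\<^sup>2 \<le> 0"
  proof (rule field_le_epsilon)
    fix d :: real assume d: "d > 0"
    \<comment> \<open>Dividing by \<open>A + 1\<close> instead of \<open>A\<close> covers the case
      \<open>A = 0\<close>.\<close>
    have "\<mu> x0 y * (u y - u x0)\<^sup>2 \<le> A * (sqrt (d / (A + 1)))\<^sup>2"
      using d A by (intro bound) simp
    also have "\<dots> \<le> d"
      using d A by (simp add: field_simps)
    finally show "\<mu> x0 y * (u y - u x0)\<^sup>2 \<le> 0 + d"
      by simp
  qed
  moreover have "\<mu> x0 y > 0"
    using y by (simp add: nbrs_def edges_def)
  ultimately show "u y = u x0"
    by (simp add: mult_le_0_iff)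
qed

section \<open>The linear and the strong cut-offs\<close>

text \<open>Along an edge the function drops by at most \<open>1 / R\<close>. Where its value
  exceeds \<open>2 / R\<close>, it therefore loses less than half, which keeps the neighbouring
  values positive and bounds the increments of the reciprocal.\<close>

lemma cutoff_linear:
  assumes R: "R > 0"
  shows "cutoff x0 R (2 / R) (\<lambda>x. max 0 (1 - real (gdist \<mu> x0 x) / R))"
proof -
  define \<phi> where "\<phi> x = max 0 (1 - real (gdist \<mu> x0 x) / R)" for x
  have "\<phi> x = 0" if "x \<notin> gball \<mu> x0 R" for x
    using that R by (simp add: \<phi>_def gball_def field_simps)
  moreover have "(\<forall>y\<in>insert x (nbrs \<mu> x). \<phi> y > 0) \<and>
      (\<phi> x)\<^sup>2 * laplacian \<mu> m (\<lambda>y. 1 / \<phi> y) x \<le> D_m \<mu> m * (2 / R)" if x: "\<phi> x > 2 / R" for x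
  proof -
    have nb: "\<phi> y \<ge> \<phi> x - 1 / R" "\<phi> y \<ge> \<phi> x / 2" "\<phi> y > 0" if "y \<in> nbrs \<mu> x" for y
    proof -
      have "real (gdist \<mu> x0 y) / R \<le> (real (gdist \<mu> x0 x) + 1) / R"
        using gdist_nbrs[OF that, of x0] R by (intro divide_right_mono) auto
      then show 1: "\<phi> y \<ge> \<phi> x - 1 / R"
        using divide_pos_pos[OF zero_less_one R] unfolding \<phi>_def add_divide_distrib by linarith
      show 2: "\<phi> y \<ge> \<phi> x / 2"
        using 1 x by simp
      have "2 / R > 0"
        using R by simp
      then show "\<phi> y > 0"
        using 2 x by linarith
    qed
    have \<phi>x: "\<phi> x > 0"
      using x R by (meson divide_pos_pos less_trans zero_less_numeral)
    have "laplacian \<mu> m (\<lambda>y. 1 / \<phi> y) x \<le> D_m \<mu> m * (2 / R / (\<phi> x)\<^sup>2)"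
    proof (rule laplacian_le_of_increments)
      fix y assume y: "y \<in> nbrs \<mu> x"
      have "1 / \<phi> y - 1 / \<phi> x = (\<phi> x - \<phi> y) / (\<phi> x * \<phi> y)"
        using \<phi>x nb(3)[OF y] by (simp add: field_simps)
      also have "\<dots> \<le> (1 / R) / (\<phi> x * (\<phi> x / 2))"
        using \<phi>x nb[OF y] R by (intro frac_le mult_left_mono) auto
      finally show "1 / \<phi> y - 1 / \<phi> x \<le> 2 / R / (\<phi> x)\<^sup>2"
        by (simp add: power2_eq_square)
    qed (use R in auto)
    then have "(\<phi> x)\<^sup>2 * laplacian \<mu> m (\<lambda>y. 1 / \<phi> y) x \<le> D_m \<mu> m * (2 / R)"
      using \<phi>x R by (simp add: field_simps)
    then show ?thesis
      using nb(3) \<phi>x by auto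
  qed
  ultimately have "cutoff x0 R (2 / R) \<phi>"
    unfolding cutoff_def by (auto simp: \<phi>_def not_le[symmetric])
  then show ?thesis
    by (simp add: \<phi>_def[abs_def])
qed

text \<open>The sign of \<open>c\<close> is unrestricted, and the absolute value supplies the
  nonnegative quality parameter of the maximum principle.\<close>

lemma cutoff_of_strong_cutoff:
  assumes "strong_cutoff \<mu> m 0 c R x0 (gball \<mu> x0 R) \<phi>"
  shows "cutoff x0 R (\<bar>c\<bar> / R\<^sup>2) \<phi>"
  unfolding cutoff_def
proof (intro conjI ballI)
  have \<phi>: "0 \<le> \<phi> x" "\<phi> x0 = 1" "x \<notin> gball \<mu> x0 R \<Longrightarrow> \<phi> x = 0" for x
    using assms by (auto simp: strong_cutoff_def)
  show "\<forall>x. 0 \<le> \<phi> x" "\<phi> x0 = 1" "\<forall>x. x \<notin> gball \<mu> x0 R \<longrightarrow> \<phi> x = 0"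
    using \<phi> by auto
  fix x assume x: "x \<in> gball \<mu> x0 R"
  \<comment> \<open>For \<open>R = 0\<close> all quotients are 0 by the convention on division by
    zero.\<close>
  have c: "c / (2 * R\<^sup>2) \<le> \<bar>c\<bar> / R\<^sup>2" "c / R\<^sup>2 \<le> \<bar>c\<bar> / R\<^sup>2"
    by (auto simp: divide_simps)
  consider "\<phi> x < c / (2 * R\<^sup>2)" | "\<And>y. y \<in> insert x (nbrs \<mu> x) \<Longrightarrow> \<phi> y \<noteq> 0"
      "(\<phi> x)\<^sup>2 * laplacian \<mu> m (\<lambda>y. 1 / \<phi> y) x \<le> D_m \<mu> m * (c / R\<^sup>2)"
    using assms x unfolding strong_cutoff_def by auto
  then show "\<phi> x \<le> \<bar>c\<bar> / R\<^sup>2 \<or> (\<forall>y\<in>insert x (nbrs \<mu> x). \<phi> y > 0) \<and>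
      (\<phi> x)\<^sup>2 * laplacian \<mu> m (\<lambda>y. 1 / \<phi> y) x \<le> D_m \<mu> m * (\<bar>c\<bar> / R\<^sup>2)"
  proof cases
    case 1
    then show ?thesis
      using c(1) by linarith
  next
    case 2
    have "D_m \<mu> m * (c / R\<^sup>2) \<le> D_m \<mu> m * (\<bar>c\<bar> / R\<^sup>2)"
      using c(2) D_m_nonneg by (intro mult_left_mono)
    moreover have "\<phi> y > 0" if "y \<in> insert x (nbrs \<mu> x)" for y
      using 2(1)[OF that] \<phi>(1)[of y] by simp
    ultimately show ?thesis
      using 2(2) by fastforce
  qed
qed

end

section \<open>The two growth regimes\<close>

theorem theorem2p6:
  fixes \<mu> :: "'v \<Rightarrow> 'v \<Rightarrow> real" and m :: "'v \<Rightarrow> real" and n :: real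
  assumes "weighted_graph \<mu> m" and "n > 0" and "CDE \<mu> m n 0"
  shows "(\<forall>u. harmonic \<mu> m u \<and> sub_square_root_growth \<mu> u \<longrightarrow> (\<exists>a. \<forall>x. u x = a)) \<and>
    ((\<exists>c. \<forall>x0. \<forall>\<^sub>F R in at_top. \<exists>\<phi>. strong_cutoff \<mu> m 0 c R x0 (gball \<mu> x0 R) \<phi>) \<longrightarrow>
     (\<forall>u. harmonic \<mu> m u \<and> sublinear_growth \<mu> u \<longrightarrow> (\<exists>a. \<forall>x. u x = a)))"
proof (intro conjI allI impI; elim conjE exE)
  interpret weighted_graph \<mu> m
    by fact
  {
    fix u assume u: "harmonic \<mu> m u" "sub_square_root_growth \<mu> u"
    then obtain p where p: "max_on_ball \<mu> u p \<in> o[at_top](\<lambda>R. R powr (1/2))"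
      by (auto simp: sub_square_root_growth_def)
    show "\<exists>a. \<forall>x. u x = a"
    proof (rule harmonic_constant_of_growth[OF assms(3,2) u(1) p])
      \<comment> \<open>For positive \<open>R\<close> the squared scale equals \<open>R\<close>, so
        this is the quality \<open>2 / R\<close> of the linear cut-off.\<close>
      show "\<forall>\<^sub>F R in at_top. \<exists>\<phi>. cutoff x0 R (2 / (R powr (1/2))\<^sup>2) \<phi>" for x0
        using eventually_gt_at_top[of 0]
        by eventually_elim (auto simp: powr_half_sqrt intro!: cutoff_linear exI)
      show "\<forall>\<^sub>F R in at_top. (R + k) powr (1/2) \<le> 2 * R powr (1/2)" for k :: real
        by real_asymp
      show "\<forall>\<^sub>F R :: real in at_top. R powr (1/2) > 0"
        by real_asymp
    qed simp
  next
    fix u c assume u: "harmonic \<mu> m u" "sublinear_growth \<mu> u"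
      and c: "\<forall>x0. \<forall>\<^sub>F R in at_top. \<exists>\<phi>. strong_cutoff \<mu> m 0 c R x0 (gball \<mu> x0 R) \<phi>"
    then obtain p where p: "max_on_ball \<mu> u p \<in> o[at_top](\<lambda>R. R)"
      by (auto simp: sublinear_growth_def)
    show "\<exists>a. \<forall>x. u x = a"
    proof (rule harmonic_constant_of_growth[OF assms(3,2) u(1) p])
      show "\<forall>\<^sub>F R in at_top. \<exists>\<phi>. cutoff x0 R (\<bar>c\<bar> / R\<^sup>2) \<phi>" for x0
        using c[rule_format, of x0] by eventually_elim (blast intro: cutoff_of_strong_cutoff)
      show "\<forall>\<^sub>F R in at_top. R + k \<le> 2 * R" for k :: real
        by real_asymp
    qed (simp_all add: eventually_gt_at_top)
  }
qed

end
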